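(* Let $X$ be a Tychonoff space and let $\mathscr{P}$ be an ideal of closed sets in $X$ with $|X_\mathscr{P}|\geq 3$. Then $\chi(G(C_\mathscr{P}(X)))=\chi(AG(C_\mathscr{P}(X)))$, where $\chi$ denotes the chromatic number.
   Context: $C(X)$ is the ring of all real valued continuous functions on the Tychonoff (completely regular Hausdorff) space $X$; $Z(f)=\{x\in X: f(x)=0\}$. An ideal of closed sets in $X$ is a nonempty family $\mathscr{P}$ of closed subsets of $X$ such that $A,B\in\mathscr{P}$ implies $A\cup B\in\mathscr{P}$, and $A\in\mathscr{P}$, $C\subset A$ with $C$ closed in $X$ implies $C\in\mathscr{P}$. $C_\mathscr{P}(X)=\{f\in C(X): cl_X(X\setminus Z(f))\in\mathscr{P}\}$, a commutative ring (possibly without identity). $X_\mathscr{P}$ is the set of all $x\in X$ having an open neighborhood $V$ with $cl_XV\in\mathscr{P}$. For a commutative ring $R$, $Z(R)^*$ is the set of nonzero zero divisors, i.e. nonzero $a\in R$ with $ab=0$ for some nonzero $b\in R$, and $ann(a)=\{r\in R: ra=0\}$. The annihilator graph $AG(R)$ is the simple graph with vertex set $Z(R)^*$ in which distinct $a,b$ are adjacent iff $ann(a)\cup ann(b)\neq ann(ab)$. On $C_\mathscr{P}(X)$ define the equivalence relation $f\sim g$ iff $int_XZ(f)\cap X_\mathscr{P}=int_XZ(g)\cap X_\mathscr{P}$. Fix a set $S\subset C_\mathscr{P}(X)$ containing exactly one element of each equivalence class, and put $V(C_\mathscr{P}(X))=\{f\in S\setminus\{0\}: int_XZ(f)\cap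 X_\mathscr{P}\neq\emptyset\}$, which is a subset of $Z(C_\mathscr{P}(X))^*$. $G(C_\mathscr{P}(X))$ is the induced subgraph of $AG(C_\mathscr{P}(X))$ with vertex set $V(C_\mathscr{P}(X))$. The chromatic number $\chi(H)$ of a graph $H$ is the least cardinal $\Lambda$ (finite or infinite) such that the vertices of $H$ can be labeled with $\Lambda$ colors so that adjacent vertices receive different colors. *)

theory Defs
  imports
    "HOL-Analysis.Urysohn"
    "HOL-Library.Function_Algebras"
    "Graph_Theory.Graph_Theory"
begin

unbundle cardinal_syntax

section \<open>Annihilator graphs of commutative rings\<close>

text \<open>
  A commutative ring, possibly without identity, is represented by its underlying set \<open>R\<close>, a
  subset of a type of class \<^class>\<open>comm_ring\<close> that contains \<open>0\<close> and is closed under the ring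
  operations. Annihilators and zero divisors are taken inside \<open>R\<close>, not inside the ambient type.
\<close>

definition ann :: "'r::comm_ring set \<Rightarrow> 'r \<Rightarrow> 'r set" where
  "ann R a = {r \<in> R. r * a = 0}"

definition nonzero_zero_divisors :: "'r::comm_ring set \<Rightarrow> 'r set" where
  "nonzero_zero_divisors R = {a \<in> R. a \<noteq> 0 \<and> (\<exists>b\<in>R. b \<noteq> 0 \<and> a * b = 0)}"

text \<open>A simple graph, possibly infinite, is a symmetric loop-free digraph without parallel arcs.\<close>

definition annihilator_graph :: "'r::comm_ring set \<Rightarrow> 'r pair_pre_digraph" where
  "annihilator_graph R =
     \<lparr> pverts = nonzero_zero_divisors R,
       parcs = {(a, b). a \<in> nonzero_zero_divisors R \<and> b \<in> nonzero_zero_divisors R \<and>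
                        a \<noteq> b \<and> ann R a \<union> ann R b \<noteq> ann R (a * b)} \<rparr>"

lemma annihilator_graph_simple: "pair_bidirected_digraph (annihilator_graph R)"
proof
  show "symmetric (with_proj (annihilator_graph R))"
    by (auto simp: annihilator_graph_def symmetric_def sym_def Un_commute mult.commute)
qed (auto simp: annihilator_graph_def)


section \<open>Chromatic number\<close>

text \<open>
  Cardinals are represented, up to \<^const>\<open>ordIso\<close>, by relations that satisfy \<^const>\<open>Card_order\<close>.
\<close>

definition colorable :: "('v, 'e) pre_digraph \<Rightarrow> 'c rel \<Rightarrow> bool" where
  "colorable G r \<longleftrightarrow>
     (\<exists>c. c ` verts G \<subseteq> Field r \<and> (\<forall>u\<in>verts G. \<forall>v\<in>verts G. u \<rightarrow>\<^bsub>G\<^esub> v \<longrightarrow> c u \<noteq> c v))"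

text \<open>
  A loop-free graph can be colored by its own vertices, so the least cardinal is attained by a
  cardinal on the type of vertices. That it is least among the cardinals on all other
  types as well is shown in \<open>chromatic_number_least\<close>.
\<close>

definition is_chromatic_number :: "('v, 'e) pre_digraph \<Rightarrow> 'v rel \<Rightarrow> bool" where
  "is_chromatic_number G r \<longleftrightarrow>
     Card_order r \<and> colorable G r \<and> (\<forall>s::'v rel. Card_order s \<and> colorable G s \<longrightarrow> r \<le>o s)"

definition chromatic_number :: "('v, 'e) pre_digraph \<Rightarrow> 'v rel" where
  "chromatic_number G = (SOME r. is_chromatic_number G r)"

lemma chromatic_number_works:
  fixes G :: "('v, 'e) pre_digraph"
  assumes loop_free: "\<And>v. \<not> v \<rightarrow>\<^bsub>G\<^esub> v"
  shows "is_chromatic_number G (chromatic_number G)"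
proof -
  let ?R = "{r::'v rel. Card_order r \<and> colorable G r}"
  have "colorable G (card_of (UNIV::'v set))"
    unfolding colorable_def using loop_free
    by (intro exI[of _ "\<lambda>v. v"]) (auto simp: Field_card_of)
  then have ne: "?R \<noteq> {}"
    using card_of_Card_order by blast
  have "\<exists>r\<in>?R. \<forall>s\<in>?R. r \<le>o s"
    by (rule exists_minim_Card_order[OF ne]) blast
  then have "\<exists>r. is_chromatic_number G r"
    by (auto simp: is_chromatic_number_def)
  then show ?thesis
    unfolding chromatic_number_def by (rule someI_ex)
qed

lemma colorable_card_of_image:
  assumes "c ` verts G \<subseteq> Field s" "\<forall>u\<in>verts G. \<forall>v\<in>verts G. u \<rightarrow>\<^bsub>G\<^esub> v \<longrightarrow> c u \<noteq> c v"
  obtains r :: "'v rel" where "Card_order r" "colorable (G :: ('v, 'e) pre_digraph) r"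
    "r \<le>o card_of (Field (s :: 'c rel))"
proof -
  let ?g = "inv_into (verts G) c"
  let ?A = "?g ` c ` verts G"
  have inj: "inj_on ?g (c ` verts G)"
    by (rule inj_on_inv_into) simp
  have "colorable G (card_of ?A)"
    unfolding colorable_def
  proof (intro exI[of _ "?g \<circ> c"] conjI ballI impI)
    fix u v assume uv: "u \<in> verts G" "v \<in> verts G" "u \<rightarrow>\<^bsub>G\<^esub> v"
    then have "c u \<noteq> c v"
      using assms(2) by blast
    then show "(?g \<circ> c) u \<noteq> (?g \<circ> c) v"
      using inj uv by (auto dest: inj_onD)
  qed (auto simp: Field_card_of)
  moreover have "card_of ?A \<le>o card_of (Field s)"
    by (meson assms(1) card_of_image card_of_mono1 ordLeq_transitive)
  ultimately show thesis
    using that card_of_Card_order by blast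
qed

lemma chromatic_number_least:
  fixes G :: "('v, 'e) pre_digraph" and s :: "'c rel"
  assumes "\<And>v. \<not> v \<rightarrow>\<^bsub>G\<^esub> v" "Card_order s" "colorable G s"
  shows "chromatic_number G \<le>o s"
proof -
  obtain c where c: "c ` verts G \<subseteq> Field s"
      "\<forall>u\<in>verts G. \<forall>v\<in>verts G. u \<rightarrow>\<^bsub>G\<^esub> v \<longrightarrow> c u \<noteq> c v"
    using assms(3) unfolding colorable_def by blast
  obtain r :: "'v rel" where r: "Card_order r" "colorable G r" "r \<le>o card_of (Field s)"
    using colorable_card_of_image[OF c] .
  have "chromatic_number G \<le>o r"
    using chromatic_number_works[OF assms(1)] r by (auto simp: is_chromatic_number_def)
  then show ?thesis
    using r(3) card_of_Field_ordIso[OF assms(2)] by (meson ordLeq_transitive ordLeq_ordIso_trans)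
qed


section \<open>The rings of continuous functions determined by ideals of closed sets\<close>

definition tychonoff_space :: "'a topology \<Rightarrow> bool" where
  "tychonoff_space X \<longleftrightarrow> completely_regular_space X \<and> Hausdorff_space X"

definition closed_ideal :: "'a topology \<Rightarrow> 'a set set \<Rightarrow> bool" where
  "closed_ideal X \<P> \<longleftrightarrow>
     \<P> \<noteq> {} \<and> (\<forall>A\<in>\<P>. closedin X A) \<and>
     (\<forall>A\<in>\<P>. \<forall>B\<in>\<P>. A \<union> B \<in> \<P>) \<and>
     (\<forall>A\<in>\<P>. \<forall>C. C \<subseteq> A \<and> closedin X C \<longrightarrow> C \<in> \<P>)"

text \<open>
  HOL functions are total: an element of \<open>C(X)\<close> is represented by its extension by \<open>0\<close> outside the
  carrier of \<open>X\<close>, so that equality of representatives is equality on \<open>X\<close>, and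
  the pointwise operations on functions are the ring operations of \<open>C(X)\<close>.
\<close>

definition cont_funs :: "'a topology \<Rightarrow> ('a \<Rightarrow> real) set" where
  "cont_funs X = {f. continuous_map X euclideanreal f \<and> (\<forall>x. x \<notin> topspace X \<longrightarrow> f x = 0)}"

definition zero_set :: "'a topology \<Rightarrow> ('a \<Rightarrow> real) \<Rightarrow> 'a set" where
  "zero_set X f = {x \<in> topspace X. f x = 0}"

definition C_ideal :: "'a topology \<Rightarrow> 'a set set \<Rightarrow> ('a \<Rightarrow> real) set" where
  "C_ideal X \<P> = {f \<in> cont_funs X. X closure_of (topspace X - zero_set X f) \<in> \<P>}"

definition X_ideal :: "'a topology \<Rightarrow> 'a set set \<Rightarrow> 'a set" where
  "X_ideal X \<P> = {x \<in> topspace X. \<exists>V. openin X V \<and> x \<in> V \<and> X closure_of V \<in> \<P>}"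

lemma C_ideal_subring:
  assumes "closed_ideal X \<P>"
  shows "0 \<in> C_ideal X \<P>"
    and "f \<in> C_ideal X \<P> \<Longrightarrow> g \<in> C_ideal X \<P> \<Longrightarrow> f - g \<in> C_ideal X \<P>"
    and "f \<in> C_ideal X \<P> \<Longrightarrow> g \<in> C_ideal X \<P> \<Longrightarrow> f * g \<in> C_ideal X \<P>"
proof -
  have empty: "{} \<in> \<P>"
    and un: "\<And>A B. A \<in> \<P> \<Longrightarrow> B \<in> \<P> \<Longrightarrow> A \<union> B \<in> \<P>"
    and sub: "\<And>A B. A \<in> \<P> \<Longrightarrow> X closure_of B \<subseteq> A \<Longrightarrow> X closure_of B \<in> \<P>"
    using assms unfolding closed_ideal_def
    by (metis closedin_empty empty_subsetI all_not_in_conv, metis, metis closedin_closure_of)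
  have "zero_set X 0 = topspace X"
    by (simp add: zero_set_def)
  moreover have "continuous_map X euclideanreal 0"
    by (simp add: zero_fun_def)
  ultimately show "0 \<in> C_ideal X \<P>"
    by (simp add: C_ideal_def cont_funs_def empty)
  assume f: "f \<in> C_ideal X \<P>" and g: "g \<in> C_ideal X \<P>"
  let ?U = "topspace X - zero_set X f \<union> (topspace X - zero_set X g)"
  have U: "X closure_of ?U \<in> \<P>"
    using f g un by (simp add: C_ideal_def)
  have small: "X closure_of B \<in> \<P>" if "B \<subseteq> ?U" for B
    by (rule sub[OF U closure_of_mono[OF that]])
  have "X closure_of (topspace X - zero_set X (f - g)) \<in> \<P>"
    by (rule small) (auto simp: zero_set_def)
  moreover have "X closure_of (topspace X - zero_set X (f * g)) \<in> \<P>"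
    by (rule small) (auto simp: zero_set_def)
  moreover have "f - g \<in> cont_funs X" "f * g \<in> cont_funs X"
    using f g by (simp_all add: C_ideal_def cont_funs_def fun_diff_def times_fun_def
        continuous_map_diff continuous_map_real_mult)
  ultimately show "f - g \<in> C_ideal X \<P>" "f * g \<in> C_ideal X \<P>"
    by (simp_all add: C_ideal_def)
qed


section \<open>The graph \<open>G(C\<^sub>\<P>(X))\<close>\<close>

definition ideal_equiv ::
    "'a topology \<Rightarrow> 'a set set \<Rightarrow> ('a \<Rightarrow> real) \<Rightarrow> ('a \<Rightarrow> real) \<Rightarrow> bool" where
  "ideal_equiv X \<P> f g \<longleftrightarrow>
     X interior_of zero_set X f \<inter> X_ideal X \<P> = X interior_of zero_set X g \<inter> X_ideal X \<P>"

definition class_representatives ::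
    "'a topology \<Rightarrow> 'a set set \<Rightarrow> ('a \<Rightarrow> real) set \<Rightarrow> bool" where
  "class_representatives X \<P> S \<longleftrightarrow>
     S \<subseteq> C_ideal X \<P> \<and> (\<forall>f \<in> C_ideal X \<P>. \<exists>!g. g \<in> S \<and> ideal_equiv X \<P> f g)"

definition V_ideal ::
    "'a topology \<Rightarrow> 'a set set \<Rightarrow> ('a \<Rightarrow> real) set \<Rightarrow> ('a \<Rightarrow> real) set" where
  "V_ideal X \<P> S = {f \<in> S - {0}. X interior_of zero_set X f \<inter> X_ideal X \<P> \<noteq> {}}"

definition G_ideal ::
    "'a topology \<Rightarrow> 'a set set \<Rightarrow> ('a \<Rightarrow> real) set \<Rightarrow>
     ('a \<Rightarrow> real, ('a \<Rightarrow> real) \<times> ('a \<Rightarrow> real)) pre_digraph" where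
  "G_ideal X \<P> S = with_proj (annihilator_graph (C_ideal X \<P>)) \<restriction> V_ideal X \<P> S"

end

theory Submission
  imports Defs
begin

text \<open>
  Two elements of \<open>C\<^sub>\<P>(X)\<close> in the same class have the same annihilator: every \<open>r\<close> in the ring has
  an open cozero set, which lies in \<open>X\<^sub>\<P>\<close>, so \<open>r * f = 0\<close> says exactly that this cozero set is
  contained in \<open>int Z(f) \<inter> X\<^sub>\<P>\<close> (\<open>ann_C_ideal\<close>). Adjacency of distinct vertices \<open>a\<close>, \<open>b\<close> of the
  annihilator graph depends only on the annihilators of \<open>a\<close> and \<open>b\<close>, because \<open>ann(ab)\<close> does; and
  since the ring is reduced, elements with equal annihilators are never adjacent
  (\<open>annihilator_graph_arc_transfer\<close>). Hence \<open>AG\<close> arises from \<open>G\<close> by blowing up each vertex to an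
  independent set: sending an element to the representative of its class is a graph homomorphism
  \<open>AG \<rightarrow> G\<close>, and the inclusion is one in the other direction. Homomorphisms pull colorings back,
  so the two chromatic numbers bound each other.

  Complete regularity enters only through the bump functions of \<open>C_ideal_bump\<close>, which make every
  vertex of \<open>G\<close> a zero divisor.
\<close>

section \<open>Graph homomorphisms and chromatic numbers\<close>

lemma colorable_pullback:
  assumes "colorable H s"
    and "\<And>v. v \<in> verts G \<Longrightarrow> h v \<in> verts H"
    and "\<And>u v. u \<in> verts G \<Longrightarrow> v \<in> verts G \<Longrightarrow> u \<rightarrow>\<^bsub>G\<^esub> v \<Longrightarrow> h u \<rightarrow>\<^bsub>H\<^esub> h v"
  shows "colorable G s"
proof -
  obtain c where c: "c ` verts H \<subseteq> Field s"
      "\<forall>u\<in>verts H. \<forall>v\<in>verts H. u \<rightarrow>\<^bsub>H\<^esub> v \<longrightarrow> c u \<noteq> c v"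
    using assms(1) unfolding colorable_def by blast
  show ?thesis
    unfolding colorable_def
  proof (intro exI[of _ "c \<circ> h"] conjI ballI impI)
    show "(c \<circ> h) ` verts G \<subseteq> Field s"
      using c(1) assms(2) by auto
    show "(c \<circ> h) u \<noteq> (c \<circ> h) v" if "u \<in> verts G" "v \<in> verts G" "u \<rightarrow>\<^bsub>G\<^esub> v" for u v
      using c(2) assms(2,3) that by simp
  qed
qed

lemma chromatic_number_hom_le:
  assumes "\<And>v. \<not> v \<rightarrow>\<^bsub>G\<^esub> v" and "\<And>v. \<not> v \<rightarrow>\<^bsub>H\<^esub> v"
    and "\<And>v. v \<in> verts G \<Longrightarrow> h v \<in> verts H"
    and "\<And>u v. u \<in> verts G \<Longrightarrow> v \<in> verts G \<Longrightarrow> u \<rightarrow>\<^bsub>G\<^esub> v \<Longrightarrow> h u \<rightarrow>\<^bsub>H\<^esub> h v"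
  shows "chromatic_number G \<le>o chromatic_number H"
proof (rule chromatic_number_least[OF assms(1)])
  have H: "is_chromatic_number H (chromatic_number H)"
    by (rule chromatic_number_works[OF assms(2)])
  then show "Card_order (chromatic_number H)"
    by (simp add: is_chromatic_number_def)
  show "colorable G (chromatic_number H)"
    using H colorable_pullback[OF _ assms(3,4)] by (auto simp: is_chromatic_number_def)
qed

section \<open>Adjacency in the annihilator graph of a reduced ring\<close>

lemma annihilator_graph_dominates_iff:
  "a \<rightarrow>\<^bsub>with_proj (annihilator_graph R)\<^esub> b \<longleftrightarrow>
     a \<in> nonzero_zero_divisors R \<and> b \<in> nonzero_zero_divisors R \<and> a \<noteq> b \<and>
     ann R a \<union> ann R b \<noteq> ann R (a * b)"
  by (auto simp: annihilator_graph_def arcs_ends_def arc_to_ends_def)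

text \<open>
  The annihilator of a product is determined by those of the factors: \<open>r * (a * b) = 0\<close> means
  \<open>r * b \<in> ann R a\<close>, so \<open>a\<close> may be exchanged, and likewise \<open>b\<close>.
\<close>

lemma ann_mult_cong:
  assumes closed: "\<And>x y. x \<in> R \<Longrightarrow> y \<in> R \<Longrightarrow> x * y \<in> R"
    and "a' \<in> R" "b \<in> R" "ann R a = ann R a'" "ann R b = ann R b'"
  shows "ann R (a * b) = ann R (a' * b')"
proof -
  have "ann R (a * b) = {r \<in> R. r * b \<in> ann R a}"
    using closed \<open>b \<in> R\<close> by (auto simp: ann_def ac_simps)
  also have "\<dots> = {r \<in> R. r * a' \<in> ann R b}"
    using closed \<open>a' \<in> R\<close> \<open>b \<in> R\<close> unfolding \<open>ann R a = ann R a'\<close> by (auto simp: ann_def ac_simps)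
  also have "\<dots> = ann R (a' * b')"
    using closed \<open>a' \<in> R\<close> unfolding \<open>ann R b = ann R b'\<close> by (auto simp: ann_def ac_simps)
  finally show ?thesis .
qed

lemma ann_square_reduced:
  assumes closed: "\<And>x y. x \<in> R \<Longrightarrow> y \<in> R \<Longrightarrow> x * y \<in> R"
    and reduced: "\<And>x. x \<in> R \<Longrightarrow> x * x = 0 \<Longrightarrow> x = 0"
    and "a \<in> R"
  shows "ann R (a * a) = ann R a"
proof -
  have "r * a = 0" if "r \<in> R" "r * (a * a) = 0" for r
  proof (rule reduced)
    have "r * a * (r * a) = r * (r * (a * a))"
      by (simp add: ac_simps)
    then show "r * a * (r * a) = 0"
      using that by simp
  qed (use closed that \<open>a \<in> R\<close> in blast)
  moreover have "r * (a * a) = 0" if "r * a = 0" for r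
    using that by (simp flip: mult.assoc)
  ultimately show ?thesis
    by (auto simp: ann_def)
qed

text \<open>
  The point of the reducedness hypothesis is that \<open>a'\<close> and \<open>b'\<close> are then automatically distinct:
  if \<open>a' = b'\<close>, then \<open>ann R (a * b) = ann R (a' * a') = ann R a'\<close>, which is also
  \<open>ann R a \<union> ann R b\<close>.
\<close>

lemma annihilator_graph_arc_transfer:
  assumes closed: "\<And>x y. x \<in> R \<Longrightarrow> y \<in> R \<Longrightarrow> x * y \<in> R"
    and reduced: "\<And>x. x \<in> R \<Longrightarrow> x * x = 0 \<Longrightarrow> x = 0"
    and arc: "a \<rightarrow>\<^bsub>with_proj (annihilator_graph R)\<^esub> b"
    and "a' \<in> nonzero_zero_divisors R" "b' \<in> nonzero_zero_divisors R"
    and ann: "ann R a = ann R a'" "ann R b = ann R b'"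
  shows "a' \<rightarrow>\<^bsub>with_proj (annihilator_graph R)\<^esub> b'"
proof -
  have ab: "b \<in> nonzero_zero_divisors R" "ann R a \<union> ann R b \<noteq> ann R (a * b)"
    using arc unfolding annihilator_graph_dominates_iff by blast+
  have R: "a' \<in> R" "b \<in> R"
    using assms(4) ab(1) by (simp_all add: nonzero_zero_divisors_def)
  have "ann R (a * b) = ann R (a' * b')"
    by (rule ann_mult_cong[OF closed R ann])
  then have ne: "ann R a' \<union> ann R b' \<noteq> ann R (a' * b')"
    using ab(2) by (simp only: ann not_False_eq_True)
  moreover have "ann R (a' * a') = ann R a'"
    by (rule ann_square_reduced[OF closed reduced R(1)])
  ultimately have "a' \<noteq> b'"
    by blast
  then show ?thesis
    using ne assms(4,5) unfolding annihilator_graph_dominates_iff by blast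
qed

section \<open>Annihilators in \<open>C\<^sub>\<P>(X)\<close>\<close>

lemma closure_of_subset_in_ideal:
  assumes "closed_ideal X \<P>" "X closure_of V \<in> \<P>" "U \<subseteq> V"
  shows "X closure_of U \<in> \<P>"
  using assms closure_of_mono[OF assms(3), of X] unfolding closed_ideal_def
  by (meson closedin_closure_of)

lemma openin_cozero_set:
  assumes "f \<in> cont_funs X"
  shows "openin X (topspace X - zero_set X f)"
proof -
  have "continuous_map X euclideanreal f"
    using assms by (simp add: cont_funs_def)
  then have "closedin X {x \<in> topspace X. f x \<in> {0}}"
    by (rule closedin_continuous_map_preimage) simp
  then show ?thesis
    by (simp add: zero_set_def openin_diff)
qed

lemma cozero_set_subset_X_ideal:
  assumes "f \<in> C_ideal X \<P>"
  shows "topspace X - zero_set X f \<subseteq> X_ideal X \<P>"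
  using assms openin_cozero_set[of f X] by (auto simp: C_ideal_def X_ideal_def)

lemma mult_eq_0_iff_cozero_subset:
  assumes "r \<in> C_ideal X \<P>" "f \<in> C_ideal X \<P>"
  shows "r * f = 0 \<longleftrightarrow> topspace X - zero_set X r \<subseteq> X interior_of zero_set X f \<inter> X_ideal X \<P>"
proof -
  have out: "r x = 0" if "x \<notin> topspace X" for x
    using assms(1) that by (auto simp: C_ideal_def cont_funs_def)
  have "r * f = 0 \<longleftrightarrow> topspace X - zero_set X r \<subseteq> zero_set X f"
    using out by (fastforce simp: fun_eq_iff zero_set_def)
  \<comment> \<open>The cozero set of \<open>r\<close> is open, so it lies in \<open>Z(f)\<close> as soon as it lies in the interior.\<close>
  also have "\<dots> \<longleftrightarrow> topspace X - zero_set X r \<subseteq> X interior_of zero_set X f"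
    using openin_cozero_set[of r X] assms(1) interior_of_subset[of X "zero_set X f"]
    by (auto simp: C_ideal_def interior_of_maximal_eq)
  finally show ?thesis
    using cozero_set_subset_X_ideal[OF assms(1)] by blast
qed

lemma ann_C_ideal:
  assumes "f \<in> C_ideal X \<P>"
  shows "ann (C_ideal X \<P>) f = {r \<in> C_ideal X \<P>.
           topspace X - zero_set X r \<subseteq> X interior_of zero_set X f \<inter> X_ideal X \<P>}"
  using mult_eq_0_iff_cozero_subset[OF _ assms] by (auto simp: ann_def)

lemma ideal_equiv_imp_ann_eq:
  assumes "f \<in> C_ideal X \<P>" "g \<in> C_ideal X \<P>" "ideal_equiv X \<P> f g"
  shows "ann (C_ideal X \<P>) f = ann (C_ideal X \<P>) g"
  using assms by (simp add: ann_C_ideal ideal_equiv_def)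

lemma C_ideal_reduced:
  assumes "f * f = 0"
  shows "f = (0 :: 'a \<Rightarrow> real)"
  using assms by (simp add: fun_eq_iff)

lemma zero_set_eq_topspace_iff:
  assumes "f \<in> cont_funs X"
  shows "zero_set X f = topspace X \<longleftrightarrow> f = 0"
  using assms by (auto simp: cont_funs_def zero_set_def fun_eq_iff)

section \<open>Vertices\<close>

text \<open>
  For \<open>x\<close> in \<open>X\<^sub>\<P>\<close> with a neighborhood \<open>V\<close> whose closure is in \<open>\<P>\<close>, complete regularity gives a
  function whose cozero set lies in \<open>U \<inter> V\<close>; lying inside \<open>V\<close> puts it into \<open>C\<^sub>\<P>(X)\<close>.
\<close>

lemma C_ideal_bump:
  assumes "completely_regular_space X" "closed_ideal X \<P>"
    and "openin X U" "x \<in> U" "x \<in> X_ideal X \<P>"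
  obtains f where "f \<in> C_ideal X \<P>" "f x \<noteq> 0" "topspace X - zero_set X f \<subseteq> U"
proof -
  obtain V where V: "openin X V" "x \<in> V" "X closure_of V \<in> \<P>"
    using assms(5) by (auto simp: X_ideal_def)
  let ?W = "U \<inter> V"
  have x: "x \<in> topspace X"
    using assms(3,4) openin_subset by blast
  have "closedin X (topspace X - ?W)" "x \<in> topspace X - (topspace X - ?W)"
    using assms(3,4) V x by auto
  then obtain h where h: "continuous_map X (top_of_set {0..1::real}) h" "h x = 0"
      "h ` (topspace X - ?W) \<subseteq> {1}"
    using assms(1) unfolding completely_regular_space_def by blast
  define f where "f y = (if y \<in> topspace X then 1 - h y else 0)" for y
  have "continuous_map X euclideanreal (\<lambda>y. 1 - h y)"
    using h(1) by (intro continuous_intros) (simp add: continuous_map_in_subtopology)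
  then have "continuous_map X euclideanreal f"
    by (rule continuous_map_eq) (simp add: f_def)
  then have "f \<in> cont_funs X"
    by (simp add: cont_funs_def f_def)
  moreover have coz: "topspace X - zero_set X f \<subseteq> ?W"
    using h(3) by (auto simp: f_def zero_set_def)
  moreover have "X closure_of (topspace X - zero_set X f) \<in> \<P>"
    by (rule closure_of_subset_in_ideal[OF assms(2) V(3)]) (use coz in blast)
  moreover have "f x \<noteq> 0"
    using x h(2) by (simp add: f_def)
  ultimately show thesis
    using that by (auto simp: C_ideal_def)
qed

lemma zero_divisor_C_ideal_iff:
  assumes "completely_regular_space X" "closed_ideal X \<P>" "f \<in> C_ideal X \<P>"
  shows "f \<in> nonzero_zero_divisors (C_ideal X \<P>) \<longleftrightarrow>
           f \<noteq> 0 \<and> X interior_of zero_set X f \<inter> X_ideal X \<P> \<noteq> {}"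
proof -
  let ?I = "X interior_of zero_set X f \<inter> X_ideal X \<P>"
  have "(\<exists>g\<in>C_ideal X \<P>. g \<noteq> 0 \<and> f * g = 0) \<longleftrightarrow> ?I \<noteq> {}"
  proof
    assume "\<exists>g\<in>C_ideal X \<P>. g \<noteq> 0 \<and> f * g = 0"
    then obtain g where g: "g \<in> C_ideal X \<P>" "g \<noteq> 0" "g * f = 0"
      by (auto simp: mult.commute)
    then have "topspace X - zero_set X g \<noteq> {}"
      using zero_set_eq_topspace_iff[of g X] by (auto simp: C_ideal_def zero_set_def)
    then show "?I \<noteq> {}"
      using mult_eq_0_iff_cozero_subset[OF g(1) assms(3)] g(3) by blast
  next
    assume "?I \<noteq> {}"
    then obtain x where x: "x \<in> X interior_of zero_set X f" "x \<in> X_ideal X \<P>"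
      by blast
    obtain g where g: "g \<in> C_ideal X \<P>" "g x \<noteq> 0"
        "topspace X - zero_set X g \<subseteq> X interior_of zero_set X f"
      using C_ideal_bump[OF assms(1,2) openin_interior_of x] .
    have "g * f = 0"
      using mult_eq_0_iff_cozero_subset[OF g(1) assms(3)] g(3) cozero_set_subset_X_ideal[OF g(1)]
      by blast
    then show "\<exists>g\<in>C_ideal X \<P>. g \<noteq> 0 \<and> f * g = 0"
      using g(1,2) by (intro bexI[of _ g]) (auto simp: mult.commute)
  qed
  then show ?thesis
    using assms(3) by (auto simp: nonzero_zero_divisors_def)
qed

lemma ideal_equiv_zero_iff:
  assumes "f \<in> C_ideal X \<P>"
  shows "ideal_equiv X \<P> f 0 \<longleftrightarrow> f = 0"
proof
  assume "ideal_equiv X \<P> f 0"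
  then have "X_ideal X \<P> \<subseteq> X interior_of zero_set X f"
    by (auto simp: ideal_equiv_def zero_set_def X_ideal_def)
  then have "topspace X - zero_set X f = {}"
    using cozero_set_subset_X_ideal[OF assms] interior_of_subset[of X "zero_set X f"] by blast
  then show "f = 0"
    using assms zero_set_eq_topspace_iff[of f X] by (auto simp: C_ideal_def zero_set_def)
qed (simp add: ideal_equiv_def)

lemma zero_divisor_ideal_equiv:
  assumes "completely_regular_space X" "closed_ideal X \<P>"
    and "f \<in> C_ideal X \<P>" "g \<in> C_ideal X \<P>" "ideal_equiv X \<P> f g"
    and "f \<in> nonzero_zero_divisors (C_ideal X \<P>)"
  shows "g \<in> nonzero_zero_divisors (C_ideal X \<P>)"
  using assms ideal_equiv_zero_iff[OF assms(3)] ideal_equiv_zero_iff[OF assms(4)]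
  by (simp add: zero_divisor_C_ideal_iff ideal_equiv_def)

lemma V_ideal_eq:
  assumes "completely_regular_space X" "closed_ideal X \<P>" "class_representatives X \<P> S"
  shows "V_ideal X \<P> S = S \<inter> nonzero_zero_divisors (C_ideal X \<P>)"
  using zero_divisor_C_ideal_iff[OF assms(1,2)] assms(3)
  by (auto simp: V_ideal_def class_representatives_def)

lemma G_ideal_dominates_iff:
  "f \<rightarrow>\<^bsub>G_ideal X \<P> S\<^esub> g \<longleftrightarrow> f \<in> V_ideal X \<P> S \<and> g \<in> V_ideal X \<P> S \<and>
     f \<rightarrow>\<^bsub>with_proj (annihilator_graph (C_ideal X \<P>))\<^esub> g"
  by (auto simp: G_ideal_def induce_subgraph_def arcs_ends_def arc_to_ends_def)

section \<open>Equality of the chromatic numbers\<close>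

theorem theorem4p28:
  fixes X :: "'a topology" and \<P> :: "'a set set" and S :: "('a \<Rightarrow> real) set"
  assumes "tychonoff_space X"
    and "closed_ideal X \<P>"
    and "infinite (X_ideal X \<P>) \<or> card (X_ideal X \<P>) \<ge> 3"
    and "class_representatives X \<P> S"
  shows "chromatic_number (G_ideal X \<P> S)
           =o chromatic_number (with_proj (annihilator_graph (C_ideal X \<P>)))"
proof -
  let ?R = "C_ideal X \<P>"
  let ?Z = "nonzero_zero_divisors ?R"
  let ?AG = "with_proj (annihilator_graph ?R)" and ?G = "G_ideal X \<P> S"
  have creg: "completely_regular_space X"
    using assms(1) by (simp add: tychonoff_space_def)
  have V: "V_ideal X \<P> S = S \<inter> ?Z"
    using V_ideal_eq[OF creg assms(2,4)] .
  have verts: "verts ?AG = ?Z" "verts ?G = V_ideal X \<P> S"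
    by (simp_all add: annihilator_graph_def G_ideal_def)
  have loop_free: "\<not> v \<rightarrow>\<^bsub>?AG\<^esub> v" "\<not> v \<rightarrow>\<^bsub>?G\<^esub> v" for v
    unfolding G_ideal_dominates_iff annihilator_graph_dominates_iff by blast+
  have "\<forall>f\<in>?R. \<exists>g. g \<in> S \<and> ideal_equiv X \<P> f g"
    using assms(4) by (auto simp: class_representatives_def)
  then obtain rep where rep: "\<And>f. f \<in> ?R \<Longrightarrow> rep f \<in> S \<and> ideal_equiv X \<P> f (rep f)"
    by metis
  have repR: "rep f \<in> ?R" if "f \<in> ?R" for f
    using rep[OF that] assms(4) by (auto simp: class_representatives_def)
  have inR: "f \<in> ?R" if "f \<in> ?Z" for f
    using that by (simp add: nonzero_zero_divisors_def)
  have rep_zd: "rep f \<in> ?Z" if f: "f \<in> ?Z" for f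
    using zero_divisor_ideal_equiv[OF creg assms(2) inR[OF f] repR[OF inR[OF f]] _ f]
      rep[OF inR[OF f]] by blast
  have rep_V: "rep f \<in> V_ideal X \<P> S" if "f \<in> ?Z" for f
    using rep_zd[OF that] rep[OF inR[OF that]] by (simp add: V)
  have rep_ann: "ann ?R f = ann ?R (rep f)" if f: "f \<in> ?Z" for f
    using ideal_equiv_imp_ann_eq[OF inR[OF f] repR[OF inR[OF f]]] rep[OF inR[OF f]] by blast
  have "chromatic_number ?AG \<le>o chromatic_number ?G"
  proof (rule chromatic_number_hom_le[where h = rep, OF loop_free])
    show "rep f \<in> verts ?G" if "f \<in> verts ?AG" for f
      using that rep_V unfolding verts by blast
    fix f g assume "f \<in> verts ?AG" "g \<in> verts ?AG" and arc: "f \<rightarrow>\<^bsub>?AG\<^esub> g"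
    then have f: "f \<in> ?Z" and g: "g \<in> ?Z"
      unfolding verts by blast+
    have "rep f \<rightarrow>\<^bsub>?AG\<^esub> rep g"
      by (rule annihilator_graph_arc_transfer[OF C_ideal_subring(3)[OF assms(2)] C_ideal_reduced
            arc rep_zd[OF f] rep_zd[OF g] rep_ann[OF f] rep_ann[OF g]])
    then show "rep f \<rightarrow>\<^bsub>?G\<^esub> rep g"
      using rep_V[OF f] rep_V[OF g] unfolding G_ideal_dominates_iff by blast
  qed
  moreover have "chromatic_number ?G \<le>o chromatic_number ?AG"
  proof (rule chromatic_number_hom_le[where h = id, OF loop_free(2,1)])
    show "id f \<in> verts ?AG" if "f \<in> verts ?G" for f
      using that unfolding verts V by simp
    show "id f \<rightarrow>\<^bsub>?AG\<^esub> id g" if "f \<rightarrow>\<^bsub>?G\<^esub> g" for f g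
      using that unfolding G_ideal_dominates_iff id_apply by blast
  qed
  ultimately show ?thesis
    by (simp add: ordIso_iff_ordLeq)
qed

end
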